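(* Let $f,g,F$ be as in the context (with $F=f+g$ and $F^*=\inf F>-\infty$). Suppose that there exists $L>0$ such that $$f(x)\le f(y)+\langle\nabla f(y),x-y\rangle+\frac{L}{2}\|x-y\|^2\quad\text{for all }x,y\in\mathrm{dom}\,g,$$ that $g$ is convex with bounded domain, $D_g:=\sup_{x,y\in\mathrm{dom}\,g}\|x-y\|<\infty$, and that for every $x\in\mathrm{dom}\,g$ the set $\operatorname{argmin}_{v\in\mathbb{E}}\{\langle\nabla f(x),v\rangle+g(v)\}$ is nonempty. Let $\{x^k\}$ be a sequence generated by the auto-conditioned conditional gradient method (AC-CGM) with parameters $\alpha>\frac12$, $L_0>0$ and $x^0\in\mathrm{dom}\,g$, satisfying $v^k\ne x^{k-1}$ for all $k\ge1$. Then: (i) For all $k\ge1$, $$\min_{1\le l\le k}G_l\le\max\left\{\frac{4\alpha L_0\Delta+2C}{(2\alpha-1)L_0k},\ \sqrt{\frac{\alpha\max\{L_0,L\}D_g^2(4\alpha L_0\Delta+2C)}{(2\alpha-1)L_0k}}\right\}=\mathcal{O}(k^{-\frac12}),$$ where $\Delta:=F(x^0)-F^*$ and $C:=(\max\{L_0,L\}-L_0)\max_{l\in\overline{\mathcal{S}}}G_l<\infty$. (ii) The sequence $\{F(x^k)\}$ converges to a finite value, and any accumulation point of $\{x^k\}$ is an l-stationary point of the problem of minimizing $F$ over $\mathbb{E}$.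
   Context: $\mathbb{E}$ is a finite-dimensional real inner product space with inner product $\langle\cdot,\cdot\rangle$ and induced norm $\|\cdot\|$; $\mathrm{dom}\,\phi=\{x\mid\phi(x)<\infty\}$. Problem: minimize $F(x):=f(x)+g(x)$ over $x\in\mathbb{E}$, where $f:\mathbb{E}\to(-\infty,\infty]$ is lower semicontinuous and continuously differentiable on an open set including $\mathrm{dom}\,g$, $g:\mathbb{E}\to(-\infty,\infty]$ is proper and lower semicontinuous, and $F^*:=\inf_{x\in\mathbb{E}}F(x)>-\infty$. Subdifferentials: for $x\in\mathrm{dom}\,F=\mathrm{dom}\,g$, the Fréchet subdifferential is $\widehat\partial F(x)=\{\xi\in\mathbb{E}\mid\liminf_{y\to x}\frac{F(y)-F(x)-\langle\xi,y-x\rangle}{\|y-x\|}\ge0\}$, with $\widehat\partial F(x)=\emptyset$ for $x\notin\mathrm{dom}\,g$; the limiting subdifferential is $\partial F(x)=\{\xi\mid\exists\,x^k\to x,\ F(x^k)\to F(x),\ \xi^k\to\xi,\ \xi^k\in\widehat\partial F(x^k)\}$. An l-stationary point is a point $x^*\in\mathrm{dom}\,g$ with $0\in\partial F(x^* )$. Frank–Wolfe gap at $x\in\mathrm{dom}\,g$: $G(x):=\max_{v\in\mathbb{E}}\{\langle\nabla f(x),x-v\rangle+g(x)-g(v)\}\ge0$. AC-CGM: given $x^0\in\mathrm{dom}\,g$, $\alpha>\frac12$, $L_0>0$, for $k=1,2,\dots$ compute $v^k\in\operatorname{argmin}_{v\in\mathbb{E}}\{\langle\nabla f(x^{k-1}),v\rangle+g(v)\}$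 (any choice); $\gamma_k=\max\{L_0,\dots,L_{k-1}\}$; $G_k=G(x^{k-1})=\langle\nabla f(x^{k-1}),x^{k-1}-v^k\rangle+g(x^{k-1})-g(v^k)$; $\tau_k=\min\Big\{1,\dfrac{G_k}{\alpha\gamma_k\|x^{k-1}-v^k\|^2}\Big\}$; $x^k=(1-\tau_k)x^{k-1}+\tau_kv^k$; $L_k=\dfrac{2\big(f(x^k)-f(x^{k-1})-\langle\nabla f(x^{k-1}),x^k-x^{k-1}\rangle\big)}{\|x^k-x^{k-1}\|^2}$. That a sequence is generated by the algorithm includes that all these quantities are well defined, i.e. $v^k\ne x^{k-1}$ and $\tau_k>0$ (equivalently $G_k>0$), so that $x^k\ne x^{k-1}$, for all $k\ge1$. Index sets: with $\beta:=\alpha+\frac12$, $\mathcal{S}:=\{k\ge1\mid\beta\gamma_k\ge L_k\}$ and $\overline{\mathcal{S}}:=\{1,2,\dots\}\setminus\mathcal{S}$. A maximum over the empty set is taken to be $0$. *)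

theory Defs
  imports "HOL-Analysis.Analysis" "HOL-Library.Landau_Symbols"
begin

definition edom :: "('a \<Rightarrow> ereal) \<Rightarrow> 'a set" where
  "edom \<phi> = {x. \<phi> x < \<infinity>}"

definition proper_fun :: "('a \<Rightarrow> ereal) \<Rightarrow> bool" where
  "proper_fun \<phi> \<longleftrightarrow> (\<forall>x. - \<infinity> < \<phi> x) \<and> (\<exists>x. \<phi> x < \<infinity>)"

definition lower_semicont :: "('a::topological_space \<Rightarrow> ereal) \<Rightarrow> bool" where
  "lower_semicont \<phi> \<longleftrightarrow> (\<forall>x. \<phi> x \<le> Liminf (at x) \<phi>)"

definition ereal_convex :: "('a::real_vector \<Rightarrow> ereal) \<Rightarrow> bool" where
  "ereal_convex \<phi> \<longleftrightarrow>
     (\<forall>x y. \<forall>t. 0 < t \<and> t < 1 \<longrightarrow>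
        \<phi> ((1 - t) *\<^sub>R x + t *\<^sub>R y) \<le> ereal (1 - t) * \<phi> x + ereal t * \<phi> y)"

text \<open>The gradient is only meaningful where the function is finite on a neighbourhood of the
  point and differentiable there; this is part of \<open>cont_diff_on\<close>, which is used for open sets.\<close>

definition grad :: "('a::real_inner \<Rightarrow> ereal) \<Rightarrow> 'a \<Rightarrow> 'a" where
  "grad f x = (THE D. GDERIV (\<lambda>y. real_of_ereal (f y)) x :> D)"

definition cont_diff_on :: "('a::real_inner \<Rightarrow> ereal) \<Rightarrow> 'a set \<Rightarrow> bool" where
  "cont_diff_on f U \<longleftrightarrow>
     (\<forall>x\<in>U. \<bar>f x\<bar> \<noteq> \<infinity>) \<and>
     (\<forall>x\<in>U. \<exists>D. GDERIV (\<lambda>y. real_of_ereal (f y)) x :> D) \<and>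
     continuous_on U (grad f)"

definition frechet_subdiff :: "('a::real_inner \<Rightarrow> ereal) \<Rightarrow> 'a \<Rightarrow> 'a set" where
  "frechet_subdiff F x =
     (if x \<in> edom F
      then {\<xi>. 0 \<le> Liminf (at x) (\<lambda>y. (F y - F x - ereal (\<xi> \<bullet> (y - x))) / ereal (norm (y - x)))}
      else {})"

definition limiting_subdiff :: "('a::real_inner \<Rightarrow> ereal) \<Rightarrow> 'a \<Rightarrow> 'a set" where
  "limiting_subdiff F x =
     {\<xi>. \<exists>X \<Xi>. X \<longlonglongrightarrow> x \<and> (\<lambda>k. F (X k)) \<longlonglongrightarrow> F x \<and> \<Xi> \<longlonglongrightarrow> \<xi> \<and>
           (\<forall>k::nat. \<Xi> k \<in> frechet_subdiff F (X k))}"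

definition l_stationary :: "('a::real_inner \<Rightarrow> ereal) \<Rightarrow> ('a \<Rightarrow> ereal) \<Rightarrow> 'a \<Rightarrow> bool" where
  "l_stationary f g x \<longleftrightarrow> x \<in> edom g \<and> 0 \<in> limiting_subdiff (\<lambda>y. f y + g y) x"

definition lin_argmin :: "('a::real_inner \<Rightarrow> ereal) \<Rightarrow> ('a \<Rightarrow> ereal) \<Rightarrow> 'a \<Rightarrow> 'a set" where
  "lin_argmin f g x = {v. is_arg_min (\<lambda>w. ereal (grad f x \<bullet> w) + g w) (\<lambda>_. True) v}"

text \<open>The Frank--Wolfe gap. The maximum is written as a supremum; it is attained, exactly at
  the points of \<open>lin_argmin f g x\<close>, whenever \<open>x \<in> edom g\<close>, \<open>g\<close> is proper and that set is
  nonempty.\<close>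

definition fw_gap :: "('a::real_inner \<Rightarrow> ereal) \<Rightarrow> ('a \<Rightarrow> ereal) \<Rightarrow> 'a \<Rightarrow> ereal" where
  "fw_gap f g x = (SUP v. ereal (grad f x \<bullet> (x - v)) + g x - g v)"

text \<open>\<open>ac_cgm f g \<alpha> L0 x0 x v \<gamma> G \<tau> Ls\<close>: the sequences \<open>x, v, \<gamma>, G, \<tau>, Ls\<close> are generated by AC-CGM,
  all iterations being well defined. The entries \<open>v 0\<close>, \<open>\<gamma> 0\<close>, \<open>G 0\<close>, \<open>\<tau> 0\<close> carry no meaning.\<close>

definition ac_cgm ::
  "('a::real_inner \<Rightarrow> ereal) \<Rightarrow> ('a \<Rightarrow> ereal) \<Rightarrow> real \<Rightarrow> real \<Rightarrow> 'a \<Rightarrow>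
   (nat \<Rightarrow> 'a) \<Rightarrow> (nat \<Rightarrow> 'a) \<Rightarrow> (nat \<Rightarrow> real) \<Rightarrow> (nat \<Rightarrow> real) \<Rightarrow> (nat \<Rightarrow> real) \<Rightarrow> (nat \<Rightarrow> real) \<Rightarrow> bool"
where
  "ac_cgm f g \<alpha> L0 x0 x v \<gamma> G \<tau> Ls \<longleftrightarrow>
     x 0 = x0 \<and> Ls 0 = L0 \<and>
     (\<forall>k\<ge>1.
        v k \<in> lin_argmin f g (x (k - 1)) \<and>
        \<gamma> k = Max (Ls ` {..<k}) \<and>
        G k = real_of_ereal (fw_gap f g (x (k - 1))) \<and>
        v k \<noteq> x (k - 1) \<and>
        \<tau> k = min 1 (G k / (\<alpha> * \<gamma> k * (norm (x (k - 1) - v k))\<^sup>2)) \<and>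
        0 < \<tau> k \<and>
        x k = (1 - \<tau> k) *\<^sub>R x (k - 1) + \<tau> k *\<^sub>R v k \<and>
        Ls k = 2 * (real_of_ereal (f (x k)) - real_of_ereal (f (x (k - 1)))
                      - grad f (x (k - 1)) \<bullet> (x k - x (k - 1)))
               / (norm (x k - x (k - 1)))\<^sup>2)"

definition good_set :: "real \<Rightarrow> (nat \<Rightarrow> real) \<Rightarrow> (nat \<Rightarrow> real) \<Rightarrow> nat set" where
  "good_set \<alpha> \<gamma> Ls = {k. 1 \<le> k \<and> (\<alpha> + 1 / 2) * \<gamma> k \<ge> Ls k}"

definition bad_set :: "real \<Rightarrow> (nat \<Rightarrow> real) \<Rightarrow> (nat \<Rightarrow> real) \<Rightarrow> nat set" where
  "bad_set \<alpha> \<gamma> Ls = {1..} - good_set \<alpha> \<gamma> Ls"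

text \<open>Maximum of a family of reals, with value 0 on the empty family. It is extended-real valued
  so that its finiteness is a claim.\<close>

definition max_or_zero :: "nat set \<Rightarrow> (nat \<Rightarrow> real) \<Rightarrow> ereal" where
  "max_or_zero A h = (if A = {} then 0 else (SUP l\<in>A. ereal (h l)))"

definition cgm_C :: "real \<Rightarrow> real \<Rightarrow> nat set \<Rightarrow> (nat \<Rightarrow> real) \<Rightarrow> ereal" where
  "cgm_C L0 L A G = ereal (max L0 L - L0) * max_or_zero A G"

definition cgm_Delta :: "('a \<Rightarrow> ereal) \<Rightarrow> ('a \<Rightarrow> ereal) \<Rightarrow> 'a \<Rightarrow> ereal" where
  "cgm_Delta f g x0 = (f x0 + g x0) - (INF x. f x + g x)"

definition cgm_bound :: "real \<Rightarrow> real \<Rightarrow> real \<Rightarrow> real \<Rightarrow> real \<Rightarrow> real \<Rightarrow> nat \<Rightarrow> real" where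
  "cgm_bound \<alpha> L0 L D \<Delta> C k =
     max ((4 * \<alpha> * L0 * \<Delta> + 2 * C) / ((2 * \<alpha> - 1) * L0 * real k))
         (sqrt (\<alpha> * max L0 L * D\<^sup>2 * (4 * \<alpha> * L0 * \<Delta> + 2 * C) / ((2 * \<alpha> - 1) * L0 * real k)))"

end

theory Submission
  imports Defs
begin

text \<open>
  The descent inequality bounds every \<open>L\<^sub>k\<close> by \<open>L\<close>, and every bad iteration raises \<open>\<gamma>\<close> by a fixed
  amount while \<open>\<gamma> \<le> max L0 L\<close>, so the bad iterations are finite in number. At a good iteration \<open>F\<close>
  decreases by at least a fixed multiple of \<open>\<tau>\<^sub>k G\<^sub>k\<close>; at a bad one it misses this decrease by at most
  a multiple of \<open>(\<gamma>\<^sub>k\<^sub>+\<^sub>1 - \<gamma>\<^sub>k) G\<^sub>k\<close>, and these errors telescope. Hence the sum of the \<open>\<tau>\<^sub>k G\<^sub>k\<close> is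
  bounded, which gives the rate because \<open>G\<^sub>k\<close> is at most the maximum of \<open>\<tau>\<^sub>k G\<^sub>k\<close> and
  \<open>sqrt (\<alpha> max L0 L D\<^sup>2 \<tau>\<^sub>k G\<^sub>k)\<close>. In particular \<open>G\<^sub>k\<close> tends to 0, so at an accumulation point \<open>p\<close> the
  vector \<open>- grad f p\<close> is a subgradient of \<open>g\<close>, whence 0 is even a Frechet subgradient of \<open>F\<close>.
\<close>

section \<open>Scalar recursion and its curvature estimates\<close>

text \<open>Isolates the real sequences that drive the convergence argument. In the application
  \<open>d k\<close> is the distance from \<open>x (k - 1)\<close> to \<open>v k\<close>,
  \<open>D\<close> the diameter of the domain of \<open>g\<close>, \<open>M\<close> is
  \<open>max L0 L\<close>, \<open>\<phi> k\<close> the value of \<open>F\<close> at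
  \<open>x k\<close> and \<open>\<phi>inf\<close> the infimum of \<open>F\<close>.\<close>

locale auto_conditioned =
  fixes \<alpha> L0 M D \<phi>inf :: real and \<gamma> G \<tau> Ls d \<phi> :: "nat \<Rightarrow> real"
  assumes alpha: "\<alpha> > 1 / 2" and L0_pos: "L0 > 0" and L0_le_M: "L0 \<le> M"
    and Ls_0: "Ls 0 = L0"
    and Ls_le_M: "\<And>k. k \<ge> 1 \<Longrightarrow> Ls k \<le> M"
    and gamma_Max: "\<And>k. k \<ge> 1 \<Longrightarrow> \<gamma> k = Max (Ls ` {..<k})"
    and G_pos: "\<And>k. k \<ge> 1 \<Longrightarrow> G k > 0"
    and d_pos: "\<And>k. k \<ge> 1 \<Longrightarrow> d k > 0"
    and d_le: "\<And>k. k \<ge> 1 \<Longrightarrow> d k \<le> D"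
    and tau_eq: "\<And>k. k \<ge> 1 \<Longrightarrow> \<tau> k = min 1 (G k / (\<alpha> * \<gamma> k * (d k)\<^sup>2))"
    and decrease: "\<And>k. k \<ge> 1 \<Longrightarrow> \<phi> k \<le> \<phi> (k - 1) - \<tau> k * G k + Ls k / 2 * (\<tau> k * d k)\<^sup>2"
    and bounded_below: "\<And>k. \<phi>inf \<le> \<phi> k"
begin

lemma gamma_1: "\<gamma> (Suc 0) = L0"
  by (simp add: gamma_Max Ls_0 lessThan_Suc)

lemma gamma_Suc: "k \<ge> 1 \<Longrightarrow> \<gamma> (Suc k) = max (Ls k) (\<gamma> k)"
  using gamma_Max[of k] gamma_Max[of "Suc k"]
  by (simp add: lessThan_Suc Max_insert lessThan_empty_iff)

lemma gamma_mono: "k \<ge> 1 \<Longrightarrow> \<gamma> k \<le> \<gamma> (Suc k)"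
  by (simp add: gamma_Suc)

lemma gamma_bounds: "k \<ge> 1 \<Longrightarrow> L0 \<le> \<gamma> k \<and> \<gamma> k \<le> M"
proof (induction k rule: nat_induct_at_least)
  case base
  then show ?case using gamma_1 L0_le_M by simp
next
  case (Suc k)
  then show ?case using gamma_Suc[of k] Ls_le_M[of k] by (simp add: le_max_iff_disj)
qed

lemma gamma_pos: "k \<ge> 1 \<Longrightarrow> 0 < \<gamma> k"
  using gamma_bounds L0_pos by fastforce

lemma sum_gamma_diff_le: "(\<Sum>l=1..k. \<gamma> (Suc l) - \<gamma> l) \<le> M - L0"
  using gamma_bounds[of "Suc k"] by (simp add: sum_Suc_diff gamma_1)

lemma finite_bad_set: "finite (bad_set \<alpha> \<gamma> Ls)"
proof (rule ccontr)
  \<comment> \<open>The guaranteed rise of \<open>\<gamma>\<close> at a bad index \<open>l\<close>: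
    there \<open>Ls l\<close> becomes the next \<open>\<gamma>\<close> and exceeds
    \<open>\<gamma> l\<close> by more than \<open>(\<alpha> - 1 / 2) * \<gamma> l\<close>.\<close>
  let ?c = "(\<alpha> - 1 / 2) * L0"
  assume "infinite (bad_set \<alpha> \<gamma> Ls)"
  have c: "?c > 0" using alpha L0_pos by simp
  \<comment> \<open>\<open>N\<close> such rises together would exceed \<open>M - L0\<close>, the
    most that \<open>\<gamma>\<close> can gain in total.\<close>
  obtain N :: nat where N: "real N * ?c > M - L0"
    using reals_Archimedean3[OF c] by blast
  obtain B where B: "B \<subseteq> bad_set \<alpha> \<gamma> Ls" "finite B" "card B = N"
    using infinite_arbitrarily_large[OF \<open>infinite _\<close>] by blast
  have jump: "?c \<le> \<gamma> (Suc l) - \<gamma> l" if "l \<in> B" for l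
  proof -
    have l: "l \<ge> 1" "Ls l > (\<alpha> + 1 / 2) * \<gamma> l"
      using B(1) that by (auto simp: bad_set_def good_set_def)
    have "(\<alpha> - 1 / 2) * L0 \<le> (\<alpha> - 1 / 2) * \<gamma> l"
      using gamma_bounds[of l] l alpha by simp
    also have "\<dots> = (\<alpha> + 1 / 2) * \<gamma> l - \<gamma> l" by (simp add: algebra_simps)
    also have "\<dots> \<le> \<gamma> (Suc l) - \<gamma> l"
      using l gamma_Suc[of l] by simp
    finally show ?thesis .
  qed
  have sub: "B \<subseteq> {1..Max B}"
    using B by (auto simp: bad_set_def)
  have "real N * ?c \<le> (\<Sum>l\<in>B. \<gamma> (Suc l) - \<gamma> l)"
    using sum_bounded_below[of B ?c "\<lambda>l. \<gamma> (Suc l) - \<gamma> l"] jump B(3) by simp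
  also have "\<dots> \<le> (\<Sum>l=1..Max B. \<gamma> (Suc l) - \<gamma> l)"
    using sub gamma_mono by (intro sum_mono2) auto
  also have "\<dots> \<le> M - L0" by (rule sum_gamma_diff_le)
  finally show False using N by simp
qed

section \<open>Sufficient decrease and the rate for the gap\<close>

lemma tau_pos: "k \<ge> 1 \<Longrightarrow> 0 < \<tau> k"
  and tau_le_1: "k \<ge> 1 \<Longrightarrow> \<tau> k \<le> 1"
  using G_pos[of k] d_pos[of k] gamma_pos[of k] alpha by (auto simp: tau_eq)

lemma tau_G_nonneg: "k \<ge> 1 \<Longrightarrow> 0 \<le> \<tau> k * G k"
  using tau_pos[of k] G_pos[of k] by simp

lemma tau_G_le_G: "k \<ge> 1 \<Longrightarrow> \<tau> k * G k \<le> G k"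
  using tau_le_1[of k] G_pos[of k] by (simp add: mult_left_le_one_le tau_pos less_imp_le)

text \<open>Comes from the second entry of the minimum defining \<open>\<tau> k\<close>, after
  clearing the denominator and multiplying by \<open>\<tau> k\<close> once more.\<close>

lemma step_length_le:
  assumes k: "k \<ge> 1"
  shows "\<alpha> * \<gamma> k * (\<tau> k * d k)\<^sup>2 \<le> \<tau> k * G k"
proof -
  have pos: "\<alpha> * \<gamma> k * (d k)\<^sup>2 > 0"
    using alpha gamma_pos[OF k] d_pos[OF k] by simp
  have "\<tau> k \<le> G k / (\<alpha> * \<gamma> k * (d k)\<^sup>2)" using tau_eq[OF k] by simp
  then have "\<tau> k * (\<alpha> * \<gamma> k * (d k)\<^sup>2) \<le> G k" using pos by (simp add: pos_le_divide_eq)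
  then have "\<tau> k * (\<tau> k * (\<alpha> * \<gamma> k * (d k)\<^sup>2)) \<le> \<tau> k * G k"
    using tau_pos[OF k] by simp
  then show ?thesis by (simp add: power2_eq_square algebra_simps)
qed

text \<open>At a good iteration the curvature term takes at most the fraction
  \<open>(\<alpha> + 1 / 2) / (2 * \<alpha>)\<close> of \<open>\<tau> k * G k\<close>, which leaves
  \<open>(2 * \<alpha> - 1) / (4 * \<alpha>)\<close> of it as decrease. At a bad one the excess
  curvature costs at most \<open>(\<gamma> (Suc k) - \<gamma> k) * H / (2 * \<alpha> * L0)\<close>.
  Multiplying by \<open>4 * \<alpha> * L0\<close> clears the denominators.\<close>

lemma step:
  assumes k: "k \<ge> 1" and H: "\<And>l. l \<in> bad_set \<alpha> \<gamma> Ls \<Longrightarrow> G l \<le> H" and H0: "0 \<le> H"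
  shows "(2 * \<alpha> - 1) * L0 * (\<tau> k * G k)
    \<le> 4 * \<alpha> * L0 * (\<phi> (k - 1) - \<phi> k) + 2 * (\<gamma> (Suc k) - \<gamma> k) * H"
proof -
  define h q where "h = \<tau> k * G k" and "q = (\<tau> k * d k)\<^sup>2"
  have q: "0 \<le> q" "\<alpha> * \<gamma> k * q \<le> h"
    using step_length_le[OF k] by (simp_all add: h_def q_def)
  have gam: "0 \<le> \<gamma> (Suc k) - \<gamma> k" using gamma_mono[OF k] by simp
  \<comment> \<open>Valid at every iteration; the bad case below uses it as well.\<close>
  have good: "\<alpha> * ((\<alpha> + 1 / 2) * \<gamma> k * q) \<le> (\<alpha> + 1 / 2) * h"
    using mult_left_mono[OF q(2), of "\<alpha> + 1 / 2"] alpha by (simp add: mult_ac)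
  have curv: "\<alpha> * (Ls k * q) \<le> (\<alpha> + 1 / 2) * h + (\<gamma> (Suc k) - \<gamma> k) * (H / L0)"
  proof (cases "k \<in> bad_set \<alpha> \<gamma> Ls")
    case False
    then have "Ls k \<le> (\<alpha> + 1 / 2) * \<gamma> k" using k by (auto simp: bad_set_def good_set_def)
    then have "\<alpha> * (Ls k * q) \<le> \<alpha> * ((\<alpha> + 1 / 2) * \<gamma> k * q)"
      using q(1) alpha by (intro mult_left_mono mult_right_mono) auto
    moreover have "0 \<le> (\<gamma> (Suc k) - \<gamma> k) * (H / L0)" using gam H0 L0_pos by simp
    ultimately show ?thesis using good by linarith
  next
    case True
    have "\<alpha> * L0 * q \<le> \<alpha> * \<gamma> k * q"
      using q(1) alpha gamma_bounds[OF k] by (intro mult_right_mono mult_left_mono) auto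
    also have "\<dots> \<le> H"
      using q(2) tau_G_le_G[OF k] H[OF True] by (simp add: h_def)
    finally have qH: "\<alpha> * q \<le> H / L0"
      using L0_pos by (simp add: pos_le_divide_eq mult_ac)
    \<comment> \<open>As \<open>Ls k\<close> is at most \<open>\<gamma> (Suc k)\<close>, replacing
      \<open>\<gamma> k\<close> by the larger \<open>(\<alpha> + 1 / 2) * \<gamma> k\<close> splits
      the curvature into the part allowed at a good iteration and the increment of
      \<open>\<gamma>\<close>.\<close>
    have "\<gamma> k * 1 \<le> \<gamma> k * (\<alpha> + 1 / 2)"
      using gamma_pos[OF k] alpha by (intro mult_left_mono) auto
    then have "Ls k \<le> (\<alpha> + 1 / 2) * \<gamma> k + (\<gamma> (Suc k) - \<gamma> k)"
      using gamma_Suc[OF k] by (simp add: mult.commute)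
    then have "Ls k * q \<le> ((\<alpha> + 1 / 2) * \<gamma> k + (\<gamma> (Suc k) - \<gamma> k)) * q"
      using q(1) by (rule mult_right_mono)
    then have "\<alpha> * (Ls k * q) \<le> \<alpha> * (((\<alpha> + 1 / 2) * \<gamma> k + (\<gamma> (Suc k) - \<gamma> k)) * q)"
      using alpha by simp
    also have "\<dots> = \<alpha> * ((\<alpha> + 1 / 2) * \<gamma> k * q) + (\<gamma> (Suc k) - \<gamma> k) * (\<alpha> * q)"
      by (simp add: algebra_simps)
    also have "\<dots> \<le> (\<alpha> + 1 / 2) * h + (\<gamma> (Suc k) - \<gamma> k) * (H / L0)"
      by (intro add_mono good mult_left_mono[OF qH gam])
    finally show ?thesis .
  qed
  have "2 * L0 * (\<alpha> * (Ls k * q)) \<le> 2 * L0 * ((\<alpha> + 1 / 2) * h + (\<gamma> (Suc k) - \<gamma> k) * (H / L0))"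
    using curv L0_pos by simp
  also have "\<dots> = (2 * \<alpha> + 1) * L0 * h + 2 * (\<gamma> (Suc k) - \<gamma> k) * H"
    using L0_pos by (simp add: field_simps)
  finally have "2 * L0 * (\<alpha> * (Ls k * q)) \<le> (2 * \<alpha> + 1) * L0 * h + 2 * (\<gamma> (Suc k) - \<gamma> k) * H" .
  moreover have "4 * \<alpha> * L0 * (h - Ls k / 2 * q) \<le> 4 * \<alpha> * L0 * (\<phi> (k - 1) - \<phi> k)"
    using decrease[OF k] alpha L0_pos by (intro mult_left_mono) (auto simp: h_def q_def)
  ultimately show ?thesis unfolding h_def[symmetric] by (simp add: algebra_simps)
qed

text \<open>Both the differences of \<open>\<phi>\<close> and the increments of
  \<open>\<gamma>\<close> telescope, so the bound does not depend on \<open>k\<close>.\<close>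

lemma sum_tau_G_le:
  assumes H: "\<And>l. l \<in> bad_set \<alpha> \<gamma> Ls \<Longrightarrow> G l \<le> H" and H0: "0 \<le> H"
  shows "(\<Sum>l=1..k. \<tau> l * G l)
    \<le> (4 * \<alpha> * L0 * (\<phi> 0 - \<phi>inf) + 2 * ((M - L0) * H)) / ((2 * \<alpha> - 1) * L0)"
proof -
  have "(2 * \<alpha> - 1) * L0 * (\<Sum>l=1..k. \<tau> l * G l)
      \<le> (\<Sum>l=1..k. 4 * \<alpha> * L0 * (\<phi> (l - 1) - \<phi> l) + 2 * (\<gamma> (Suc l) - \<gamma> l) * H)"
    unfolding sum_distrib_left by (intro sum_mono step H H0) simp_all
  also have "\<dots> = 4 * \<alpha> * L0 * (\<Sum>l=1..k. \<phi> (l - 1) - \<phi> l) + 2 * ((\<Sum>l=1..k. \<gamma> (Suc l) - \<gamma> l) * H)"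
    by (simp add: sum.distrib sum_distrib_left sum_distrib_right mult_ac)
  also have "(\<Sum>l=1..k. \<phi> (l - 1) - \<phi> l) = \<phi> 0 - \<phi> k"
    by (induction k) auto
  also have "4 * \<alpha> * L0 * (\<phi> 0 - \<phi> k) + 2 * ((\<Sum>l=1..k. \<gamma> (Suc l) - \<gamma> l) * H)
      \<le> 4 * \<alpha> * L0 * (\<phi> 0 - \<phi>inf) + 2 * ((M - L0) * H)"
    using alpha L0_pos H0 bounded_below[of k] sum_gamma_diff_le[of k]
    by (intro add_mono mult_left_mono mult_right_mono) auto
  finally show ?thesis
    using alpha L0_pos by (simp add: pos_le_divide_eq mult.commute)
qed

text \<open>A full step gives the first entry. Otherwise \<open>\<tau> k\<close> is the unclipped
  ratio, so the square of \<open>G k\<close> is \<open>\<alpha> * \<gamma> k * (d k)\<^sup>2\<close>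
  times \<open>\<tau> k * G k\<close>, which gives the root.\<close>

lemma G_le:
  assumes k: "k \<ge> 1"
  shows "G k \<le> max (\<tau> k * G k) (sqrt (\<alpha> * M * D\<^sup>2 * (\<tau> k * G k)))"
proof (cases "\<tau> k = 1")
  case False
  have pos: "\<alpha> * \<gamma> k * (d k)\<^sup>2 > 0"
    using alpha gamma_pos[OF k] d_pos[OF k] by simp
  have "\<tau> k = G k / (\<alpha> * \<gamma> k * (d k)\<^sup>2)"
    using tau_eq[OF k] False by (simp add: min_def split: if_splits)
  then have "\<alpha> * \<gamma> k * (d k)\<^sup>2 * \<tau> k = G k"
    using pos by (metis less_irrefl nonzero_mult_div_cancel_left times_divide_eq_right)
  then have "(G k)\<^sup>2 = \<alpha> * \<gamma> k * (d k)\<^sup>2 * (\<tau> k * G k)"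
    by (simp add: power2_eq_square)
  also have "\<dots> \<le> \<alpha> * M * D\<^sup>2 * (\<tau> k * G k)"
    using alpha gamma_bounds[OF k] d_le[OF k] d_pos[OF k] L0_pos L0_le_M tau_pos[OF k] G_pos[OF k]
    by (intro mult_mono power_mono mult_nonneg_nonneg) auto
  finally have "G k \<le> sqrt (\<alpha> * M * D\<^sup>2 * (\<tau> k * G k))"
    by (rule real_le_rsqrt)
  then show ?thesis by simp
qed simp

lemma Min_G_le:
  assumes k: "k \<ge> 1" and H: "\<And>l. l \<in> bad_set \<alpha> \<gamma> Ls \<Longrightarrow> G l \<le> H" and H0: "0 \<le> H"
  shows "Min (G ` {1..k}) \<le> (let S = 4 * \<alpha> * L0 * (\<phi> 0 - \<phi>inf) + 2 * ((M - L0) * H) in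
    max (S / ((2 * \<alpha> - 1) * L0 * real k)) (sqrt (\<alpha> * M * D\<^sup>2 * S / ((2 * \<alpha> - 1) * L0 * real k))))"
proof -
  \<comment> \<open>The bound on the sum divided by \<open>k\<close>: some
    \<open>\<tau> l * G l\<close> among the first \<open>k\<close> is no larger than this
    average.\<close>
  define A where
    "A = (4 * \<alpha> * L0 * (\<phi> 0 - \<phi>inf) + 2 * ((M - L0) * H)) / ((2 * \<alpha> - 1) * L0 * real k)"
  have "\<exists>l\<in>{1..k}. \<tau> l * G l \<le> A"
  proof (rule ccontr)
    assume "\<not> ?thesis"
    then have "(\<Sum>l=1..k. A) < (\<Sum>l=1..k. \<tau> l * G l)"
      using k by (intro sum_strict_mono) (auto simp: not_le)
    also have "\<dots> \<le> (\<Sum>l=1..k. A)"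
      using sum_tau_G_le[OF H H0, of k] k by (simp add: A_def)
    finally show False by simp
  qed
  then obtain l where l: "l \<in> {1..k}" "\<tau> l * G l \<le> A" by blast
  have "Min (G ` {1..k}) \<le> G l" using l by simp
  also have "\<dots> \<le> max (\<tau> l * G l) (sqrt (\<alpha> * M * D\<^sup>2 * (\<tau> l * G l)))"
    using l by (intro G_le) simp
  also have "\<dots> \<le> max A (sqrt (\<alpha> * M * D\<^sup>2 * A))"
    using l alpha L0_pos L0_le_M by (intro max.mono real_sqrt_le_mono mult_left_mono) auto
  finally show ?thesis by (simp add: Let_def A_def)
qed

section \<open>Vanishing gaps and convergence of the values\<close>

lemma tau_G_tendsto_0: "(\<lambda>k. \<tau> (Suc k) * G (Suc k)) \<longlonglongrightarrow> 0"
proof -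
  \<comment> \<open>The inserted 0 makes \<open>H\<close> nonnegative and keeps the maximum
    meaningful when no iteration is bad.\<close>
  define H where "H = Max (insert 0 (G ` bad_set \<alpha> \<gamma> Ls))"
  have H: "G l \<le> H" if "l \<in> bad_set \<alpha> \<gamma> Ls" for l
    using that finite_bad_set by (auto simp: H_def)
  have H0: "0 \<le> H" using finite_bad_set by (simp add: H_def)
  have "summable (\<lambda>k. \<tau> (Suc k) * G (Suc k))"
  proof (rule bounded_imp_summable)
    show "0 \<le> \<tau> (Suc k) * G (Suc k)" for k by (simp add: tau_G_nonneg)
    show "(\<Sum>l\<le>k. \<tau> (Suc l) * G (Suc l))
      \<le> (4 * \<alpha> * L0 * (\<phi> 0 - \<phi>inf) + 2 * ((M - L0) * H)) / ((2 * \<alpha> - 1) * L0)" for k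
    proof -
      have "(\<Sum>l\<le>k. \<tau> (Suc l) * G (Suc l)) = (\<Sum>l=1..Suc k. \<tau> l * G l)"
        by (simp only: One_nat_def sum.atLeast1_atMost_eq lessThan_Suc_atMost)
      then show ?thesis using sum_tau_G_le[of H "Suc k"] H H0 by simp
    qed
  qed
  then show ?thesis by (rule summable_LIMSEQ_zero)
qed

lemma G_tendsto_0: "(\<lambda>k. G (Suc k)) \<longlonglongrightarrow> 0"
proof (rule tendsto_sandwich)
  show "\<forall>\<^sub>F k in sequentially. 0 \<le> G (Suc k)"
    using G_pos by (intro always_eventually) (simp add: less_imp_le)
  show "\<forall>\<^sub>F k in sequentially. G (Suc k)
      \<le> max (\<tau> (Suc k) * G (Suc k)) (sqrt (\<alpha> * M * D\<^sup>2 * (\<tau> (Suc k) * G (Suc k))))"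
    by (intro always_eventually allI G_le) simp
  have "(\<lambda>k. max (\<tau> (Suc k) * G (Suc k)) (sqrt (\<alpha> * M * D\<^sup>2 * (\<tau> (Suc k) * G (Suc k)))))
      \<longlonglongrightarrow> max 0 (sqrt (\<alpha> * M * D\<^sup>2 * 0))"
    by (intro tendsto_intros tau_G_tendsto_0)
  then show "(\<lambda>k. max (\<tau> (Suc k) * G (Suc k)) (sqrt (\<alpha> * M * D\<^sup>2 * (\<tau> (Suc k) * G (Suc k))))) \<longlonglongrightarrow> 0"
    by simp
qed simp

text \<open>Only the bad iterations, of which there are finitely many, can increase \<open>\<phi>\<close>.\<close>

lemma convergent_values: "convergent \<phi>"
proof -
  obtain N where N: "\<And>l. l \<in> bad_set \<alpha> \<gamma> Ls \<Longrightarrow> l \<le> N"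
    using finite_nat_set_iff_bounded_le[THEN iffD1, OF finite_bad_set] by blast
  have "\<phi> (Suc k + N) \<le> \<phi> (k + N)" for k
  proof -
    let ?k = "Suc (k + N)"
    have "?k \<notin> bad_set \<alpha> \<gamma> Ls" using N[of ?k] by auto
    then have L: "Ls ?k \<le> (\<alpha> + 1 / 2) * \<gamma> ?k" by (auto simp: bad_set_def good_set_def)
    \<comment> \<open>With \<open>\<alpha> > 1 / 2\<close> the curvature term is at most
      \<open>\<alpha> * \<gamma> ?k\<close> times the squared step length, hence at most
      \<open>\<tau> ?k * G ?k\<close>, and cannot outweigh the decrease.\<close>
    have "(\<alpha> + 1 / 2) * \<gamma> ?k \<le> 2 * \<alpha> * \<gamma> ?k"
      using gamma_pos[of ?k] alpha by (intro mult_right_mono) auto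
    then have "Ls ?k / 2 * (\<tau> ?k * d ?k)\<^sup>2 \<le> \<alpha> * \<gamma> ?k * (\<tau> ?k * d ?k)\<^sup>2"
      using L by (intro mult_right_mono) auto
    then show ?thesis using decrease[of ?k] step_length_le[of ?k] by simp
  qed
  then have "decseq (\<lambda>k. \<phi> (k + N))" by (auto intro: decseq_SucI)
  then have "convergent (\<lambda>k. \<phi> (k + N))"
    using decseq_convergent bounded_below unfolding convergent_def by blast
  then show ?thesis by (simp add: convergent_ignore_initial_segment)
qed

end

section \<open>Order of the bound\<close>

lemma cgm_bound_bigo: "cgm_bound \<alpha> L0 L D \<Delta> C \<in> O(\<lambda>k. real k powr (- 1 / 2))"
proof -
  define a where "a = (4 * \<alpha> * L0 * \<Delta> + 2 * C) / ((2 * \<alpha> - 1) * L0)"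
  define b where "b = \<alpha> * max L0 L * D\<^sup>2 * a"
  have "\<bar>cgm_bound \<alpha> L0 L D \<Delta> C k\<bar> \<le> (\<bar>a\<bar> + sqrt \<bar>b\<bar>) * real k powr (- 1 / 2)" if "k \<ge> 1" for k
  proof -
    have pw: "real k powr (- 1 / 2) = 1 / sqrt (real k)"
      using that by (simp add: powr_minus_divide powr_half_sqrt)
    have "sqrt (real k) \<le> sqrt (real k * real k)"
      using that by (intro real_sqrt_le_mono) simp
    then have k: "1 / real k \<le> 1 / sqrt (real k)"
      using that by (intro divide_left_mono) (auto simp del: of_nat_mult)
    have eq: "cgm_bound \<alpha> L0 L D \<Delta> C k = max (a / real k) (sqrt (b / real k))"
      unfolding cgm_bound_def a_def b_def by (simp add: mult_ac)
    have "\<bar>a / real k\<bar> \<le> \<bar>a\<bar> / sqrt (real k)"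
      using mult_left_mono[OF k, of "\<bar>a\<bar>"] by simp
    moreover have "sqrt \<bar>b / real k\<bar> = sqrt \<bar>b\<bar> / sqrt (real k)"
      by (simp add: real_sqrt_divide)
    \<comment> \<open>The root is an odd function on all reals, so a negative \<open>b\<close> is
      covered too.\<close>
    moreover have "\<bar>sqrt (b / real k)\<bar> = sqrt \<bar>b / real k\<bar>"
      by (simp add: abs_if real_sqrt_minus)
    moreover have "0 \<le> \<bar>a\<bar> / sqrt (real k)" "0 \<le> sqrt \<bar>b\<bar> / sqrt (real k)" by auto
    ultimately have "\<bar>max (a / real k) (sqrt (b / real k))\<bar>
        \<le> \<bar>a\<bar> / sqrt (real k) + sqrt \<bar>b\<bar> / sqrt (real k)"
      by linarith
    then show ?thesis unfolding eq pw by (simp add: add_divide_distrib)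
  qed
  then show ?thesis
    by (intro bigoI[of _ "\<bar>a\<bar> + sqrt \<bar>b\<bar>"] eventually_sequentiallyI[of 1]) auto
qed

section \<open>Gradient, gap and convexity in the extended reals\<close>

lemma proper_fun_finite:
  assumes "proper_fun g" "y \<in> edom g"
  shows "\<exists>a. g y = ereal a"
proof -
  have "- \<infinity> < g y" "g y < \<infinity>" using assms by (auto simp: proper_fun_def edom_def)
  then show ?thesis by (cases "g y") auto
qed

lemma not_edom_infinity: "y \<notin> edom g \<Longrightarrow> g y = \<infinity>"
  by (simp add: edom_def)

lemma cont_diff_on_finite:
  assumes "cont_diff_on f U" "y \<in> U"
  shows "\<exists>a. f y = ereal a"
proof -
  have "\<bar>f y\<bar> \<noteq> \<infinity>" using assms by (simp add: cont_diff_on_def)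
  then show ?thesis by (cases "f y") auto
qed

lemma cont_diff_on_grad:
  assumes "cont_diff_on f U" "y \<in> U"
  shows "((\<lambda>z. real_of_ereal (f z)) has_derivative (\<lambda>h. grad f y \<bullet> h)) (at y)"
proof -
  obtain D where D: "GDERIV (\<lambda>z. real_of_ereal (f z)) y :> D"
    using assms by (auto simp: cont_diff_on_def)
  \<comment> \<open>Uniqueness of the gradient makes the definite description in \<open>grad\<close>
    denote it: two vectors representing the same derivative have equal inner products with every
    vector.\<close>
  have "D' = D" if "GDERIV (\<lambda>z. real_of_ereal (f z)) y :> D'" for D'
  proof (rule iffD1[OF vector_eq_ldot], rule allI)
    fix z
    have "(\<lambda>h. h \<bullet> D') = (\<lambda>h. h \<bullet> D)"
      using that D unfolding gderiv_def by (rule has_derivative_unique)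
    then show "z \<bullet> D' = z \<bullet> D" by metis
  qed
  then have "grad f y = D" unfolding grad_def using D by (intro the_equality)
  then show ?thesis using D by (simp add: gderiv_def inner_commute)
qed

lemma lin_argmin_dom:
  assumes g: "proper_fun g" and v: "v \<in> lin_argmin f g y"
  shows "v \<in> edom g"
proof -
  obtain w where w: "g w < \<infinity>" using g by (auto simp: proper_fun_def)
  have "ereal (grad f y \<bullet> v) + g v \<le> ereal (grad f y \<bullet> w) + g w"
    using v by (simp add: lin_argmin_def is_arg_min_linorder)
  then show ?thesis using w by (auto simp: edom_def)
qed

text \<open>Each term of the supremum is a constant minus the linearised objective, which
  \<open>v\<close> minimizes; outside the domain of \<open>g\<close> the term is
  \<open>- \<infinity>\<close>.\<close>

lemma fw_gap_eq:
  assumes g: "proper_fun g" and y: "y \<in> edom g" and v: "v \<in> lin_argmin f g y"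
  shows "fw_gap f g y
    = ereal (grad f y \<bullet> (y - v) + real_of_ereal (g y) - real_of_ereal (g v))"
proof -
  obtain a b where gy: "g y = ereal a" and gv: "g v = ereal b"
    using proper_fun_finite[OF g] y lin_argmin_dom[OF g v] by blast
  have le: "ereal (grad f y \<bullet> (y - w)) + g y - g w \<le> ereal (grad f y \<bullet> (y - v)) + g y - g v" for w
  proof (cases "w \<in> edom g")
    case True
    have "ereal (grad f y \<bullet> v) + g v \<le> ereal (grad f y \<bullet> w) + g w"
      using v by (simp add: lin_argmin_def is_arg_min_linorder)
    moreover obtain c where "g w = ereal c" using proper_fun_finite[OF g True] ..
    ultimately show ?thesis by (simp add: gy gv inner_diff_right)
  next
    case False
    then show ?thesis by (simp add: not_edom_infinity gy)
  qed
  have "fw_gap f g y = ereal (grad f y \<bullet> (y - v)) + g y - g v"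
    unfolding fw_gap_def by (intro antisym SUP_least le SUP_upper UNIV_I)
  also have "\<dots> = ereal (grad f y \<bullet> (y - v) + real_of_ereal (g y) - real_of_ereal (g v))"
    by (simp add: gy gv)
  finally show ?thesis .
qed

lemma fw_gap_ge:
  assumes g: "proper_fun g" and y: "y \<in> edom g" and w: "w \<in> edom g"
  shows "ereal (grad f y \<bullet> (y - w) + real_of_ereal (g y) - real_of_ereal (g w)) \<le> fw_gap f g y"
proof -
  obtain a b where "g y = ereal a" "g w = ereal b" using proper_fun_finite[OF g] y w by blast
  then show ?thesis unfolding fw_gap_def by (intro SUP_upper2[of w]) simp_all
qed

lemma ereal_convex_real:
  assumes c: "ereal_convex g" and g: "proper_fun g" and y: "y \<in> edom g" and z: "z \<in> edom g"
    and t: "0 < t" "t \<le> 1"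
  shows "(1 - t) *\<^sub>R y + t *\<^sub>R z \<in> edom g"
    and "real_of_ereal (g ((1 - t) *\<^sub>R y + t *\<^sub>R z))
      \<le> (1 - t) * real_of_ereal (g y) + t * real_of_ereal (g z)"
proof -
  let ?u = "(1 - t) *\<^sub>R y + t *\<^sub>R z"
  obtain a b where gyz: "g y = ereal a" "g z = ereal b" using proper_fun_finite[OF g] y z by blast
  have le: "g ?u \<le> ereal ((1 - t) * real_of_ereal (g y) + t * real_of_ereal (g z))"
  \<comment> \<open>\<open>ereal_convex\<close> speaks of \<open>t < 1\<close> only, whereas the
    algorithm may take full steps.\<close>
  proof (cases "t = 1")
    case True
    then show ?thesis by (simp add: gyz)
  next
    case False
    then have "g ?u \<le> ereal (1 - t) * g y + ereal t * g z"
      using c t unfolding ereal_convex_def by simp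
    then show ?thesis by (simp add: gyz)
  qed
  then show u: "?u \<in> edom g" by (auto simp: edom_def)
  show "real_of_ereal (g ?u) \<le> (1 - t) * real_of_ereal (g y) + t * real_of_ereal (g z)"
    using le proper_fun_finite[OF g u] by auto
qed

section \<open>Lower semicontinuity and stationarity of limits\<close>

text \<open>\<open>lower_semicont\<close> sees only punctured neighbourhoods; the inequality at
  \<open>p\<close> itself adds the centre, so \<open>X\<close> may hit \<open>p\<close>.\<close>

lemma lower_semicont_eventually:
  assumes "lower_semicont \<phi>" and X: "(X \<longlongrightarrow> p) F" and c: "c < \<phi> p"
  shows "\<forall>\<^sub>F n in F. c < \<phi> (X n)"
proof -
  have "\<phi> p \<le> Liminf (at p) \<phi>" using assms(1) by (simp add: lower_semicont_def)
  then have "\<forall>\<^sub>F y in at p. c < \<phi> y" using c by (auto simp: le_Liminf_iff)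
  then have "\<forall>\<^sub>F y in nhds p. c < \<phi> y" using c by (auto simp: eventually_nhds_conv_at)
  then show ?thesis using X unfolding filterlim_iff by blast
qed

lemma lower_semicont_limit_dom:
  assumes f_gt: "\<forall>y. - \<infinity> < f y" and f: "lower_semicont f" and g: "lower_semicont g"
    and X: "(X \<longlongrightarrow> p) F" and F: "F \<noteq> bot" and b: "\<forall>\<^sub>F n in F. f (X n) + g (X n) \<le> ereal b"
  shows "p \<in> edom g"
proof (rule ccontr)
  assume "p \<notin> edom g"
  then have gp: "g p = \<infinity>" by (rule not_edom_infinity)
  obtain a where a: "ereal a < f p" using f_gt ereal_dense2 by blast
  have "\<forall>\<^sub>F n in F. ereal a < f (X n)" by (rule lower_semicont_eventually[OF f X a])
  \<comment> \<open>The threshold \<open>b - a\<close> complements the lower bound \<open>a\<close>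
    for \<open>f\<close>, pushing the sum above \<open>b\<close>.\<close>
  moreover have "\<forall>\<^sub>F n in F. ereal (b - a) < g (X n)"
    using gp by (intro lower_semicont_eventually[OF g X]) simp
  ultimately have "\<forall>\<^sub>F n in F. False"
    using b
  proof eventually_elim
    case (elim n)
    have "ereal a + ereal (b - a) < f (X n) + g (X n)" by (rule ereal_add_strict_mono2) (use elim in auto)
    then show False using elim(3) by simp
  qed
  then show False using F by (simp add: trivial_limit_def)
qed

text \<open>The first-order expansion of \<open>f\<close> at \<open>p\<close> has error
  \<open>o(norm (y - p))\<close>, and the variational inequality bounds the change of
  \<open>g\<close> below by the negative of its linear part; the two linear parts cancel.\<close>

lemma variational_imp_l_stationary:
  assumes f_gt: "\<forall>y. - \<infinity> < f y" and g: "proper_fun g"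
    and U: "edom g \<subseteq> U" and C1: "cont_diff_on f U" and p: "p \<in> edom g"
    and vi: "\<And>w. w \<in> edom g \<Longrightarrow> grad f p \<bullet> (p - w) + real_of_ereal (g p) - real_of_ereal (g w) \<le> 0"
  shows "l_stationary f g p"
proof -
  let ?F = "\<lambda>y. f y + g y" and ?f = "\<lambda>y. real_of_ereal (f y)" and ?g = "\<lambda>y. real_of_ereal (g y)"
  let ?q = "\<lambda>y. (?F y - ?F p - ereal (0 \<bullet> (y - p))) / ereal (norm (y - p))"
  have ev: "\<forall>\<^sub>F y in at p. ereal (- e) \<le> ?q y" if e: "e > 0" for e
  proof -
    have "((\<lambda>y. norm (?f y - ?f p - grad f p \<bullet> (y - p)) / norm (y - p)) \<longlongrightarrow> 0) (at p)"
      using cont_diff_on_grad[OF C1] p U by (auto simp: has_derivative_iff_norm)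
    then have "\<forall>\<^sub>F y in at p. norm (?f y - ?f p - grad f p \<bullet> (y - p)) / norm (y - p) < e"
      using e by (rule order_tendstoD)
    moreover have "\<forall>\<^sub>F y in at p. y \<noteq> p" by (simp add: eventually_at_filter)
    ultimately show ?thesis
    proof eventually_elim
      case (elim y)
      obtain a b where fp: "f p = ereal a" "g p = ereal b"
        using cont_diff_on_finite[OF C1] proper_fun_finite[OF g] p U by blast
      show ?case
      proof (cases "y \<in> edom g")
        case True
        obtain c d where fy: "f y = ereal c" "g y = ereal d"
          using cont_diff_on_finite[OF C1] proper_fun_finite[OF g] True U by blast
        have "\<bar>?f y - ?f p - grad f p \<bullet> (y - p)\<bar> < e * norm (y - p)"
          using elim by (simp add: pos_divide_less_eq)
        moreover have "grad f p \<bullet> (p - y) + ?g p - ?g y \<le> 0" by (rule vi[OF True])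
        ultimately have "- e * norm (y - p) \<le> ?f y + ?g y - (?f p + ?g p)"
          by (simp add: inner_diff_right)
        then show ?thesis
          using elim(2) by (simp add: pos_le_divide_eq fp fy)
      next
        case False
        \<comment> \<open>Since \<open>f\<close> is never \<open>- \<infinity>\<close>,
          \<open>F\<close> is infinite off the domain of \<open>g\<close>, and so is the
          quotient.\<close>
        then have "?F y = \<infinity>" using f_gt spec[of _ y] by (auto simp: not_edom_infinity)
        then show ?thesis using elim(2) by (simp only: fp) simp
      qed
    qed
  qed
  have "0 \<le> Liminf (at p) ?q"
  proof (rule ereal_le_epsilon2)
    fix e :: real assume "0 < e"
    then have "ereal (- e) \<le> Liminf (at p) ?q" by (intro Liminf_bounded ev)
    then show "0 \<le> Liminf (at p) ?q + ereal e"
      by (cases "Liminf (at p) ?q") auto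
  qed
  moreover have "p \<in> edom ?F"
    using p U C1 by (force simp: edom_def cont_diff_on_def)
  ultimately have "0 \<in> frechet_subdiff ?F p" by (simp add: frechet_subdiff_def)
  then have "0 \<in> limiting_subdiff ?F p"
    unfolding limiting_subdiff_def
    by (intro CollectI exI[of _ "\<lambda>_. p"] exI[of _ "\<lambda>_. 0"]) auto
  then show ?thesis using p by (simp add: l_stationary_def)
qed

text \<open>The gap inequality at \<open>X n\<close> passes to the limit because \<open>grad f\<close> is continuous and \<open>g\<close> is
  lower semicontinuous.\<close>

lemma gap_limit_l_stationary:
  assumes f_gt: "\<forall>y. - \<infinity> < f y" and g: "proper_fun g" and g_lsc: "lower_semicont g"
    and U: "open U" "edom g \<subseteq> U" and C1: "cont_diff_on f U" and p: "p \<in> edom g"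
    and X: "X \<longlonglongrightarrow> p" and X_dom: "\<And>n. X n \<in> edom g"
    and gap: "\<And>n. fw_gap f g (X n) = ereal (e n)" and e: "e \<longlonglongrightarrow> 0"
  shows "l_stationary f g p"
proof (rule variational_imp_l_stationary[OF f_gt g U(2) C1 p])
  let ?g = "\<lambda>y. real_of_ereal (g y)"
  fix w assume w: "w \<in> edom g"
  have "isCont (grad f) p"
    using C1 U p by (auto simp: cont_diff_on_def continuous_on_eq_continuous_at)
  then have "(\<lambda>n. grad f (X n)) \<longlonglongrightarrow> grad f p" using X by (rule isCont_tendsto_compose)
  then have lim: "(\<lambda>n. ?g w + e n - grad f (X n) \<bullet> (X n - w)) \<longlonglongrightarrow> ?g w + 0 - grad f p \<bullet> (p - w)"
    by (intro tendsto_intros e X)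
  \<comment> \<open>The slack \<open>s\<close> is there because lower semicontinuity controls only
    levels strictly below \<open>g p\<close>.\<close>
  have "?g p - s \<le> ?g w + 0 - grad f p \<bullet> (p - w)" if s: "s > 0" for s
  proof (rule tendsto_lowerbound[OF lim])
    have "ereal (?g p - s) < g p"
      using s proper_fun_finite[OF g p] by auto
    from lower_semicont_eventually[OF g_lsc X this]
    show "\<forall>\<^sub>F n in sequentially. ?g p - s \<le> ?g w + e n - grad f (X n) \<bullet> (X n - w)"
    proof eventually_elim
      case (elim n)
      then have "?g p - s < ?g (X n)"
        using proper_fun_finite[OF g X_dom[of n]] by auto
      then show ?case using fw_gap_ge[OF g X_dom[of n] w, of f] by (simp add: gap)
    qed
  qed simp
  then have "?g p \<le> ?g w + 0 - grad f p \<bullet> (p - w)"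
    by - (rule field_le_epsilon, simp only: diff_le_eq)
  then show "grad f p \<bullet> (p - w) + ?g p - ?g w \<le> 0" by simp
qed

section \<open>From the algorithm to the scalar recursion\<close>

theorem theorem3p1:
  fixes f g :: "'a::euclidean_space \<Rightarrow> ereal"
    and L L0 \<alpha> :: real
    and x0 :: 'a
    and x v :: "nat \<Rightarrow> 'a"
    and \<gamma> G \<tau> Ls :: "nat \<Rightarrow> real"
  assumes f_gt: "\<forall>y. - \<infinity> < f y"
    and f_lsc: "lower_semicont f"
    and f_C1: "\<exists>U. open U \<and> edom g \<subseteq> U \<and> cont_diff_on f U"
    and g_proper: "proper_fun g"
    and g_lsc: "lower_semicont g"
    and F_bdd: "(INF y. f y + g y) > - \<infinity>"
    and L_pos: "L > 0"
    and descent: "\<forall>y\<in>edom g. \<forall>z\<in>edom g.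
          f y \<le> f z + ereal (grad f z \<bullet> (y - z)) + ereal (L / 2 * (norm (y - z))\<^sup>2)"
    and g_convex: "ereal_convex g"
    and g_dom: "bounded (edom g)"
    and argmin_nonempty: "\<forall>y\<in>edom g. lin_argmin f g y \<noteq> {}"
    and alpha: "\<alpha> > 1 / 2"
    and L0_pos: "L0 > 0"
    and x0: "x0 \<in> edom g"
    and alg: "ac_cgm f g \<alpha> L0 x0 x v \<gamma> G \<tau> Ls"
    and v_neq: "\<forall>k\<ge>1. v k \<noteq> x (k - 1)"
  shows
    "(let Sbar = bad_set \<alpha> \<gamma> Ls;
          C = cgm_C L0 L Sbar G;
          \<Delta> = cgm_Delta f g x0;
          B = cgm_bound \<alpha> L0 L (diameter (edom g)) (real_of_ereal \<Delta>) (real_of_ereal C)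
      in (Sbar \<noteq> {} \<longrightarrow> (\<exists>m\<in>Sbar. \<forall>l\<in>Sbar. G l \<le> G m)) \<and>
         C < \<infinity> \<and>
         (\<forall>k\<ge>1. Min (G ` {1..k}) \<le> B k) \<and>
         B \<in> O(\<lambda>k. real k powr (- 1 / 2))) \<and>
     (\<exists>F_lim::real. (\<lambda>k. f (x k) + g (x k)) \<longlonglongrightarrow> ereal F_lim) \<and>
     (\<forall>p. (\<exists>r. strict_mono r \<and> (x \<circ> r) \<longlonglongrightarrow> p) \<longrightarrow> l_stationary f g p)"
proof -
  obtain U where U: "open U" "edom g \<subseteq> U" and C1: "cont_diff_on f U" using f_C1 by blast
  define rf rg where "rf = (\<lambda>y. real_of_ereal (f y))" and "rg = (\<lambda>y. real_of_ereal (g y))"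
  define \<phi> where "\<phi> k = rf (x k) + rg (x k)" for k
  define d where "d k = norm (x (k - 1) - v k)" for k
  have f_eq: "f y = ereal (rf y)" and g_eq: "g y = ereal (rg y)" if "y \<in> edom g" for y
    using cont_diff_on_finite[OF C1 subsetD[OF U(2) that]] proper_fun_finite[OF g_proper that]
    by (auto simp: rf_def rg_def)

  have x_0: "x 0 = x0" and Ls_0: "Ls 0 = L0"
    using alg by (simp_all add: ac_cgm_def)
  have v_arg: "v k \<in> lin_argmin f g (x (k - 1))"
    and gamma: "\<gamma> k = Max (Ls ` {..<k})"
    and G_fw: "G k = real_of_ereal (fw_gap f g (x (k - 1)))"
    and tau: "\<tau> k = min 1 (G k / (\<alpha> * \<gamma> k * (d k)\<^sup>2))"
    and tau_pos: "0 < \<tau> k"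
    and x_step: "x k = (1 - \<tau> k) *\<^sub>R x (k - 1) + \<tau> k *\<^sub>R v k"
    and Ls: "Ls k = 2 * (rf (x k) - rf (x (k - 1)) - grad f (x (k - 1)) \<bullet> (x k - x (k - 1)))
      / (norm (x k - x (k - 1)))\<^sup>2"
    if "k \<ge> 1" for k
    using alg that unfolding ac_cgm_def d_def rf_def by blast+
  have v_dom: "v k \<in> edom g" if "k \<ge> 1" for k
    using lin_argmin_dom[OF g_proper v_arg[OF that]] .
  have x_dom: "x k \<in> edom g" for k
  proof (induction k)
    case 0
    then show ?case using x0 x_0 by simp
  next
    case (Suc k)
    then show ?case
      using ereal_convex_real(1)[OF g_convex g_proper Suc v_dom[of "Suc k"], of "\<tau> (Suc k)"]
        x_step[of "Suc k"] tau[of "Suc k"] tau_pos[of "Suc k"] by simp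
  qed
  have F_eq: "f (x k) + g (x k) = ereal (\<phi> k)" for k
    by (simp add: f_eq g_eq x_dom \<phi>_def)
  have gap_eq: "fw_gap f g (x (k - 1)) = ereal (G k)"
    and G_eq: "G k = grad f (x (k - 1)) \<bullet> (x (k - 1) - v k) + rg (x (k - 1)) - rg (v k)"
    if "k \<ge> 1" for k
    using fw_gap_eq[OF g_proper x_dom v_arg[OF that]] G_fw[OF that] by (simp_all add: rg_def)
  have step_eq: "x k - x (k - 1) = \<tau> k *\<^sub>R (v k - x (k - 1))" if "k \<ge> 1" for k
    using x_step[OF that] by (simp add: algebra_simps)
  have norm_step: "norm (x k - x (k - 1)) = \<tau> k * d k" if "k \<ge> 1" for k
    using tau_pos[OF that] unfolding step_eq[OF that] d_def by (simp add: norm_minus_commute)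
  have d_pos: "d k > 0" if "k \<ge> 1" for k
    using v_neq that by (auto simp: d_def)
  \<comment> \<open>The definition of \<open>Ls k\<close> solved for \<open>f\<close> at
    \<open>x k\<close>: an exact expansion, with no smoothness estimate yet.\<close>
  have curvature: "rf (x k) = rf (x (k - 1)) + grad f (x (k - 1)) \<bullet> (x k - x (k - 1))
      + Ls k / 2 * (\<tau> k * d k)\<^sup>2" if "k \<ge> 1" for k
  proof -
    have "(\<tau> k * d k)\<^sup>2 \<noteq> 0" using tau_pos[OF that] d_pos[OF that] by simp
    then have "Ls k * (\<tau> k * d k)\<^sup>2
        = 2 * (rf (x k) - rf (x (k - 1)) - grad f (x (k - 1)) \<bullet> (x k - x (k - 1)))"
      by (rule nonzero_eq_divide_eq[THEN iffD1, OF _ Ls[OF that, unfolded norm_step[OF that]]])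
    then show ?thesis by (simp add: diff_divide_distrib)
  qed

  obtain Finf where Finf: "(INF y. f y + g y) = ereal Finf"
  proof -
    have "(INF y. f y + g y) \<le> ereal (\<phi> 0)" unfolding F_eq[symmetric] by (rule INF_lower) simp
    then show thesis using F_bdd that by (cases "INF y. f y + g y") auto
  qed

  interpret auto_conditioned \<alpha> L0 "max L0 L" "diameter (edom g)" Finf \<gamma> G \<tau> Ls d \<phi>
  proof
    show "\<alpha> > 1 / 2" "L0 > 0" "L0 \<le> max L0 L" "Ls 0 = L0"
      using alpha L0_pos Ls_0 by simp_all
    show "Finf \<le> \<phi> k" for k
      unfolding ereal_less_eq(3)[symmetric] Finf[symmetric] F_eq[symmetric] by (rule INF_lower) simp
    fix k :: nat assume k: "k \<ge> 1"
    show "\<gamma> k = Max (Ls ` {..<k})" by (rule gamma[OF k])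
    show "\<tau> k = min 1 (G k / (\<alpha> * \<gamma> k * (d k)\<^sup>2))" by (rule tau[OF k])
    show "d k > 0" by (rule d_pos[OF k])
    show "d k \<le> diameter (edom g)"
      using diameter_bounded_bound[OF g_dom x_dom v_dom[OF k]] by (simp add: d_def dist_norm)
    have "f (x k) \<le> f (x (k - 1)) + ereal (grad f (x (k - 1)) \<bullet> (x k - x (k - 1)))
        + ereal (L / 2 * (norm (x k - x (k - 1)))\<^sup>2)"
      using descent x_dom by blast
    then have "Ls k / 2 * (\<tau> k * d k)\<^sup>2 \<le> L / 2 * (\<tau> k * d k)\<^sup>2"
      unfolding norm_step[OF k] f_eq[OF x_dom] using curvature[OF k] by simp
    \<comment> \<open>Exact expansion and descent inequality differ only in the curvature constant,
      and the squared step length is positive.\<close>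
    then have "Ls k \<le> L" using tau_pos[OF k] d_pos[OF k] by simp
    then show "Ls k \<le> max L0 L" by simp
    have "Ls 0 \<le> \<gamma> k" unfolding gamma[OF k] using k by (intro Max_ge) auto
    then have "\<gamma> k > 0" using L0_pos Ls_0 by simp
    then have "\<alpha> * \<gamma> k * (d k)\<^sup>2 > 0" using alpha d_pos[OF k] by simp
    then show "G k > 0" using tau[OF k] tau_pos[OF k] by (simp add: zero_less_divide_iff)
    \<comment> \<open>Convexity bounds the change of \<open>g\<close> along the step; added to the
      exact expansion of \<open>f\<close>, the linear terms combine to
      \<open>- \<tau> k * G k\<close>.\<close>
    have "rg (x k) \<le> (1 - \<tau> k) * rg (x (k - 1)) + \<tau> k * rg (v k)"
      using ereal_convex_real(2)[OF g_convex g_proper x_dom v_dom[OF k] tau_pos[OF k]] tau[OF k]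
      unfolding x_step[OF k] rg_def by simp
    moreover have "grad f (x (k - 1)) \<bullet> (x k - x (k - 1))
        = \<tau> k * (grad f (x (k - 1)) \<bullet> (v k - x (k - 1)))"
      unfolding step_eq[OF k] by simp
    ultimately show "\<phi> k \<le> \<phi> (k - 1) - \<tau> k * G k + Ls k / 2 * (\<tau> k * d k)\<^sup>2"
      unfolding \<phi>_def curvature[OF k] G_eq[OF k] by (simp add: algebra_simps)
  qed

  \<comment> \<open>The rate, the limit of the values and stationarity\<close>
  define Sbar where "Sbar = bad_set \<alpha> \<gamma> Ls"
  have fin: "finite Sbar" unfolding Sbar_def by (rule finite_bad_set)
  have attained: "\<exists>m\<in>Sbar. \<forall>l\<in>Sbar. G l \<le> G m" if "Sbar \<noteq> {}"
    using Max_in[of "G ` Sbar"] Max_ge[of "G ` Sbar"] fin that by fastforce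
  \<comment> \<open>The largest gap over the bad iterations, or 0 if there are none.\<close>
  obtain H where H: "max_or_zero Sbar G = ereal H" "\<And>l. l \<in> Sbar \<Longrightarrow> G l \<le> H" "0 \<le> H"
  proof (cases "Sbar = {}")
    case True
    then show thesis using that[of 0] by (simp add: max_or_zero_def zero_ereal_def)
  next
    case False
    then obtain m where m: "m \<in> Sbar" "\<forall>l\<in>Sbar. G l \<le> G m" using attained by blast
    have "(SUP l\<in>Sbar. ereal (G l)) = ereal (G m)"
      using m by (intro antisym SUP_least SUP_upper) auto
    moreover have "0 \<le> G m"
      using m G_pos[of m] by (auto simp: Sbar_def bad_set_def less_imp_le)
    ultimately show thesis using that[of "G m"] m False by (simp add: max_or_zero_def)
  qed
  have C_eq: "cgm_C L0 L Sbar G = ereal ((max L0 L - L0) * H)"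
    by (simp add: cgm_C_def H)
  have Delta_eq: "cgm_Delta f g x0 = ereal (\<phi> 0 - Finf)"
    using F_eq[of 0] by (simp add: cgm_Delta_def Finf x_0)
  have bound: "Min (G ` {1..k}) \<le> cgm_bound \<alpha> L0 L (diameter (edom g)) (\<phi> 0 - Finf) ((max L0 L - L0) * H) k"
    if "k \<ge> 1" for k
    using Min_G_le[OF that, of H] H unfolding Sbar_def cgm_bound_def Let_def by blast
  have part1: "let Sbar = bad_set \<alpha> \<gamma> Ls;
          C = cgm_C L0 L Sbar G;
          \<Delta> = cgm_Delta f g x0;
          B = cgm_bound \<alpha> L0 L (diameter (edom g)) (real_of_ereal \<Delta>) (real_of_ereal C)
      in (Sbar \<noteq> {} \<longrightarrow> (\<exists>m\<in>Sbar. \<forall>l\<in>Sbar. G l \<le> G m)) \<and>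
         C < \<infinity> \<and>
         (\<forall>k\<ge>1. Min (G ` {1..k}) \<le> B k) \<and>
         B \<in> O(\<lambda>k. real k powr (- 1 / 2))"
    unfolding Let_def Sbar_def[symmetric] C_eq Delta_eq real_of_ereal.simps
    using attained bound cgm_bound_bigo by simp

  obtain Flim where Flim: "\<phi> \<longlonglongrightarrow> Flim" using convergent_values by (auto simp: convergent_def)
  have part2: "(\<lambda>k. f (x k) + g (x k)) \<longlonglongrightarrow> ereal Flim"
    unfolding F_eq using Flim by simp

  have part3: "l_stationary f g p" if r: "strict_mono r" and p: "(x \<circ> r) \<longlonglongrightarrow> p" for p r
  proof -
    \<comment> \<open>Convergent values are bounded, and this keeps the accumulation point in the
      domain of \<open>g\<close>.\<close>
    obtain b where "\<And>k. \<bar>\<phi> k\<bar> \<le> b"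
      using convergent_imp_Bseq[OF convergent_values] by (auto simp: Bseq_def)
    then have "\<forall>\<^sub>F k in sequentially. f ((x \<circ> r) k) + g ((x \<circ> r) k) \<le> ereal b"
      by (simp add: F_eq abs_le_iff)
    then have p_dom: "p \<in> edom g"
      by (rule lower_semicont_limit_dom[OF f_gt f_lsc g_lsc p sequentially_bot])
    \<comment> \<open>\<open>G k\<close> is the gap at \<open>x (k - 1)\<close>, so the gap at
      \<open>x (r n)\<close> is \<open>G (Suc (r n))\<close>.\<close>
    have e: "((\<lambda>k. G (Suc k)) \<circ> r) \<longlonglongrightarrow> 0"
      by (rule LIMSEQ_subseq_LIMSEQ[OF G_tendsto_0 r])
    show ?thesis
    proof (rule gap_limit_l_stationary[OF f_gt g_proper g_lsc U C1 p_dom p _ _ e])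
      show "(x \<circ> r) n \<in> edom g" for n by (simp add: x_dom)
      show "fw_gap f g ((x \<circ> r) n) = ereal (((\<lambda>k. G (Suc k)) \<circ> r) n)" for n
        using gap_eq[of "Suc (r n)"] by simp
    qed
  qed

  show ?thesis using part1 part2 part3 by blast
qed

end
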